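(* Let $n \ge 0$ be an integer and let $a \geq 2$ be an integer. Let $f \in \mathscr{C}^0(\mathbb{R},\mathbb{R})$ be such that the limit $$\lim_{h \to 0} \frac{\int_{h}^{h+1} f(t)\, dt}{h^n}$$ exists (possibly infinite). Then $f$ is a solution of the functional equation $(E_{n,a})$ if and only if it has the form $$f(x) = \lambda B_n(x) + \tau(x) \qquad (\forall x \in \mathbb{R}),$$ where $\lambda \in \mathbb{R}$ and $\tau:\mathbb{R}\to\mathbb{R}$ is a continuous $1$-periodic function which is a solution of $(E_{n,a})$.
   Context: $B_n(X)$ ($n \ge 0$) denotes the $n$-th Bernoulli polynomial, defined by the exponential generating function $\frac{t e^{Xt}}{e^t-1} = \sum_{n=0}^{+\infty} B_n(X)\frac{t^n}{n!}$. A function $g:\mathbb{R}\to\mathbb{R}$ is a solution of $(E_{n,a})$ if $g(a x) = a^{n-1} \sum_{k=0}^{a-1} g\left(x + \frac{k}{a}\right)$ for all $x \in \mathbb{R}$. $\mathscr{C}^0(\mathbb{R},\mathbb{R})$ denotes the set of continuous functions from $\mathbb{R}$ to $\mathbb{R}$. *)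

theory Defs
  imports "HOL-Analysis.Analysis" "HOL-Computational_Algebra.Formal_Power_Series"
begin

text \<open>The Bernoulli polynomial \<open>B\<^sub>n\<close>, evaluated at a real point: \<open>n!\<close> times the \<open>n\<close>-th
  coefficient of \<open>t e\<^sup>x\<^sup>t / (e\<^sup>t - 1)\<close>, read as a formal power series in \<open>t\<close> over the reals.
  Numerator and denominator both have zero constant term; since the coefficients form a field,
  \<open>div\<close> cancels the common factor \<open>t\<close> and the quotient is exact, as the lemma below confirms.\<close>

definition bernpoly :: "nat \<Rightarrow> real \<Rightarrow> real" where
  "bernpoly n x = fact n * fps_nth ((fps_X * fps_exp x) div (fps_exp 1 - 1)) n"

lemma bernpoly_generating_function:
  "Abs_fps (\<lambda>n. bernpoly n x / fact n) * (fps_exp 1 - 1) = fps_X * fps_exp x"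
proof -
  have nz: "fps_exp (1::real) - 1 \<noteq> 0"
  proof
    assume "fps_exp (1::real) - 1 = 0"
    then have "fps_nth (fps_exp (1::real) - 1) 1 = 0" by simp
    then show False by simp
  qed
  have "subdegree (fps_exp (1::real) - 1) \<le> 1"
    by (rule subdegree_leI) simp
  also have "1 \<le> subdegree (fps_X * fps_exp x)"
    by (simp add: subdegree_mult)
  finally have "(fps_exp (1::real) - 1) dvd (fps_X * fps_exp x)"
    using nz by (simp add: fps_dvd_iff)
  then have "((fps_X * fps_exp x) div (fps_exp 1 - 1)) * (fps_exp 1 - 1) = fps_X * fps_exp x"
    by (rule dvd_div_mult_self)
  then show ?thesis
    by (simp add: bernpoly_def fps_nth_inverse)
qed

text \<open>The equation \<open>(E\<^sub>n\<^sub>,\<^sub>a)\<close>. The exponent \<open>n - 1\<close> is an integer, equal to \<open>-1\<close> for \<open>n = 0\<close>.\<close>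

definition solves_E :: "nat \<Rightarrow> nat \<Rightarrow> (real \<Rightarrow> real) \<Rightarrow> bool" where
  "solves_E n a g \<longleftrightarrow>
     (\<forall>x. g (real a * x) = real a powi (int n - 1) * (\<Sum>k<a. g (x + real k / real a)))"

end

theory Submission
  imports Defs
begin

text \<open>
  Let \<open>F h\<close> be the integral of \<open>f\<close> over \<open>[h, h + 1]\<close>. Integrating \<open>(E\<^sub>n\<^sub>,\<^sub>a)\<close> over an interval
  of length \<open>1 / a\<close> turns the \<open>a\<close> summands into adjacent pieces of one unit interval and yields
  the scaling law \<open>F (a h) = a ^ n * F h\<close> (\<open>unit_integral_scaling\<close>). So the quotient
  \<open>F h / h ^ n\<close> does not change when \<open>h\<close> is divided by \<open>a\<close>; dividing over and over pushes \<open>h\<close>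
  to \<open>0\<close>, and since the quotient has a limit there it equals that limit at every
  \<open>h \<noteq> 0\<close> (\<open>scale_invariant_const\<close>). In particular the limit is finite, say \<open>c\<close>, and
  \<open>F h = c * h ^ n\<close> for all \<open>h\<close>, at \<open>0\<close> by continuity.

  Differentiating gives \<open>f (h + 1) - f h = c * n * h ^ (n - 1)\<close>, which is also the forward
  difference of \<open>c * B\<^sub>n\<close>. Hence \<open>f - c * B\<^sub>n\<close> is \<open>1\<close>-periodic. As \<open>(E\<^sub>n\<^sub>,\<^sub>a)\<close> is linear and
  \<open>B\<^sub>n\<close> itself satisfies it (Raabe's multiplication theorem, \<open>solves_E_bernpoly\<close>), this
  difference solves it too. The same two facts give the converse implication.
\<close>

section \<open>Bernoulli polynomials\<close>

lemma fps_exp_minus_one_nonzero: "c \<noteq> 0 \<Longrightarrow> fps_exp (c::real) - 1 \<noteq> 0"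
proof
  assume "c \<noteq> 0" "fps_exp c - 1 = 0"
  then have "fps_nth (fps_exp c - 1) 1 = 0" by simp
  with \<open>c \<noteq> 0\<close> show False by simp
qed

definition bernpoly_egf :: "real \<Rightarrow> real fps" where
  "bernpoly_egf x = Abs_fps (\<lambda>n. bernpoly n x / fact n)"

lemma bernpoly_egf_eq: "bernpoly_egf x * (fps_exp 1 - 1) = fps_X * fps_exp x"
  unfolding bernpoly_egf_def by (rule bernpoly_generating_function)

lemma fps_nth_bernpoly_egf: "fps_nth (bernpoly_egf x) n = bernpoly n x / fact n"
  by (simp add: bernpoly_egf_def)

lemma bernpoly_egf_shift: "bernpoly_egf (x + y) = bernpoly_egf x * fps_exp y"
proof -
  have "bernpoly_egf (x + y) * (fps_exp 1 - 1) = (bernpoly_egf x * (fps_exp 1 - 1)) * fps_exp y"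
    by (simp add: bernpoly_egf_eq fps_exp_add_mult mult.assoc)
  then have "bernpoly_egf (x + y) * (fps_exp 1 - 1) = (bernpoly_egf x * fps_exp y) * (fps_exp 1 - 1)"
    by (simp add: ac_simps)
  then show ?thesis
    using fps_exp_minus_one_nonzero[of 1] by simp
qed

lemma bernpoly_forward_difference:
  "bernpoly n (x + 1) - bernpoly n x = real n * x ^ (n - 1)"
proof -
  have "bernpoly_egf (x + 1) - bernpoly_egf x = fps_X * fps_exp x"
    by (simp add: bernpoly_egf_shift flip: bernpoly_egf_eq) (simp add: algebra_simps)
  then have "fps_nth (bernpoly_egf (x + 1) - bernpoly_egf x) n = fps_nth (fps_X * fps_exp x) n"
    by simp
  then have "(bernpoly n (x + 1) - bernpoly n x) / fact n = (if n = 0 then 0 else x ^ (n - 1) / fact (n - 1))"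
    by (simp add: fps_nth_bernpoly_egf diff_divide_distrib)
  then show ?thesis
    by (cases n) (simp_all add: divide_eq_eq)
qed

lemma continuous_on_bernpoly: "continuous_on A (bernpoly n)"
proof -
  \<comment> \<open>Expanding the shift from \<open>0\<close> shows the polynomial form, with Bernoulli numbers as coefficients.\<close>
  have "bernpoly n x = fact n * (\<Sum>i=0..n. bernpoly i 0 / fact i * (x ^ (n - i) / fact (n - i)))" for x
  proof -
    have "fps_nth (bernpoly_egf (0 + x)) n = fps_nth (bernpoly_egf 0 * fps_exp x) n"
      by (simp only: bernpoly_egf_shift)
    then have "bernpoly n x / fact n = (\<Sum>i=0..n. bernpoly i 0 / fact i * (x ^ (n - i) / fact (n - i)))"
      by (simp only: fps_nth_bernpoly_egf fps_mult_nth fps_exp_nth of_nat_fact add_0)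
    then show ?thesis
      by (simp add: divide_eq_eq mult.commute)
  qed
  then have "bernpoly n = (\<lambda>x. fact n * (\<Sum>i=0..n. bernpoly i 0 / fact i * (x ^ (n - i) / fact (n - i))))"
    by blast
  then show ?thesis
    by (simp only:) (intro continuous_intros; simp)
qed

text \<open>Under the substitution \<open>t \<mapsto> a t\<close> the translates by \<open>k / a\<close> contribute the geometric sum
  of the \<open>e\<^sup>k\<^sup>t\<close>, which converts the denominator \<open>e\<^sup>a\<^sup>t - 1\<close> into \<open>e\<^sup>t - 1\<close>.\<close>

lemma bernpoly_multiplication:
  assumes "a > 0"
  shows "real a * bernpoly n (real a * x) = real a ^ n * (\<Sum>k<a. bernpoly n (x + real k / real a))"
proof -
  let ?s = "fps_const (real a) * fps_X :: real fps"
  let ?S = "\<Sum>k<a. bernpoly_egf (x + real k / real a)"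
  let ?D = "bernpoly_egf x oo ?s"
  have D: "?D * (fps_exp (real a) - 1) = ?s * fps_exp (real a * x)"
  proof -
    have "(bernpoly_egf x * (fps_exp 1 - 1)) oo ?s = (fps_X * fps_exp x) oo ?s"
      by (simp only: bernpoly_egf_eq)
    then show ?thesis
      by (simp add: fps_compose_mult_distrib fps_compose_sub_distrib fps_exp_compose_linear)
  qed
  have "?S oo ?s = (\<Sum>k<a. ?D * fps_exp (real k))"
    using assms
    by (simp add: bernpoly_egf_shift fps_compose_sum_distrib fps_compose_mult_distrib
        fps_exp_compose_linear)
  also have "\<dots> = ?D * (\<Sum>k<a. fps_exp 1 ^ k)"
    by (simp add: sum_distrib_left fps_exp_power_mult)
  finally have S: "?S oo ?s = ?D * (\<Sum>k<a. fps_exp 1 ^ k)" .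
  have "(?S oo ?s) * (fps_exp 1 - 1) = ?D * (fps_exp 1 ^ a - 1)"
    unfolding S power_diff_1_eq by (simp only: ac_simps)
  also have "\<dots> = ?s * fps_exp (real a * x)"
    using D by (simp add: fps_exp_power_mult)
  also have "\<dots> = (fps_const (real a) * bernpoly_egf (real a * x)) * (fps_exp 1 - 1)"
    by (simp add: bernpoly_egf_eq mult.assoc)
  finally have "?S oo ?s = fps_const (real a) * bernpoly_egf (real a * x)"
    using fps_exp_minus_one_nonzero[of 1] by simp
  then have "fps_nth (?S oo ?s) n = fps_nth (fps_const (real a) * bernpoly_egf (real a * x)) n"
    by simp
  then show ?thesis
    by (simp add: fps_compose_linear fps_sum_nth fps_nth_bernpoly_egf flip: sum_divide_distrib)
qed

section \<open>The functional equation\<close>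

text \<open>Multiplying by \<open>a\<close> removes the exponent \<open>n - 1\<close>, which is negative for \<open>n = 0\<close>.\<close>

lemma solves_E_iff:
  assumes "a > 0"
  shows "solves_E n a g \<longleftrightarrow>
    (\<forall>x. real a * g (real a * x) = real a ^ n * (\<Sum>k<a. g (x + real k / real a)))"
proof -
  have "real a powi (int n - 1) = real a ^ n / real a"
    using assms by (simp add: power_int_diff)
  then have "y = real a powi (int n - 1) * z \<longleftrightarrow> real a * y = real a ^ n * z" for y z
    using assms by (simp only:) (simp add: eq_divide_eq mult.commute)
  then show ?thesis
    by (simp add: solves_E_def)
qed

lemma solves_E_bernpoly: "a > 0 \<Longrightarrow> solves_E n a (bernpoly n)"
  by (simp add: solves_E_iff bernpoly_multiplication)

lemma solves_E_add_scaled: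
  assumes "solves_E n a g" "solves_E n a h"
  shows "solves_E n a (\<lambda>x. c * g x + h x)"
proof -
  have "c * g (real a * x) + h (real a * x) =
      real a powi (int n - 1) * (\<Sum>k<a. c * g (x + real k / real a) + h (x + real k / real a))" for x
    using assms unfolding solves_E_def
    by (simp add: sum.distrib algebra_simps flip: sum_distrib_left)
  then show ?thesis
    by (simp add: solves_E_def)
qed

text \<open>In terms of an antiderivative \<open>\<Phi>\<close> of \<open>g\<close>, the functional equation says that
  \<open>\<Phi> (a h) - a ^ n * (\<Sum>k<a. \<Phi> (h + k / a))\<close> is constant in \<open>h\<close>. Comparing its values at
  \<open>h\<close> and \<open>h + 1 / a\<close>, the sum telescopes.\<close>

lemma unit_integral_scaling:
  assumes "a > 0" "solves_E n a g"
    and \<Phi>: "\<And>x. (\<Phi> has_real_derivative g x) (at x)"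
  shows "\<Phi> (real a * h + 1) - \<Phi> (real a * h) = real a ^ n * (\<Phi> (h + 1) - \<Phi> h)"
proof -
  define \<Psi> where "\<Psi> x = \<Phi> (real a * x) - real a ^ n * (\<Sum>k<a. \<Phi> (x + real k / real a))" for x
  have "(\<Psi> has_real_derivative 0) (at x)" for x
  proof -
    have "(\<Psi> has_real_derivative
        g (real a * x) * real a - real a ^ n * (\<Sum>k<a. g (x + real k / real a))) (at x)"
      unfolding \<Psi>_def
      by (auto intro!: derivative_eq_intros DERIV_chain2[OF \<Phi>])
    moreover have "real a * g (real a * x) = real a ^ n * (\<Sum>k<a. g (x + real k / real a))"
      using assms by (simp add: solves_E_iff)
    ultimately show ?thesis by (simp add: mult.commute)
  qed
  then have "\<Psi> (h + 1 / real a) = \<Psi> h"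
    by (intro DERIV_isconst_all) auto
  then have "\<Phi> (real a * h + 1) - \<Phi> (real a * h) = real a ^ n *
      ((\<Sum>k<a. \<Phi> (h + 1 / real a + real k / real a)) - (\<Sum>k<a. \<Phi> (h + real k / real a)))"
    using assms(1) by (simp add: \<Psi>_def algebra_simps)
  also have "(\<Sum>k<a. \<Phi> (h + 1 / real a + real k / real a)) - (\<Sum>k<a. \<Phi> (h + real k / real a))
      = \<Phi> (h + 1) - \<Phi> h"
  proof -
    have "(\<Sum>k<a. \<Phi> (h + 1 / real a + real k / real a)) = (\<Sum>k<a. \<Phi> (h + real (Suc k) / real a))"
      by (simp add: add_divide_distrib algebra_simps)
    then show ?thesis
      using sum_lessThan_telescope[of "\<lambda>k. \<Phi> (h + real k / real a)" a] assms(1)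
      by (simp add: sum_subtractf)
  qed
  finally show ?thesis .
qed

lemma scale_invariant_const:
  fixes G :: "real \<Rightarrow> 'b::t2_space"
  assumes a: "a > 1" and lim: "(G \<longlongrightarrow> L) (at 0)"
    and inv: "\<And>h. h \<noteq> 0 \<Longrightarrow> G (a * h) = G h"
    and "h \<noteq> 0"
  shows "G h = L"
proof -
  have step: "G (h / a ^ m) = G h" for m
  proof (induction m)
    case (Suc m)
    have "G (h / a ^ Suc m) = G (a * (h / a ^ Suc m))"
      using a \<open>h \<noteq> 0\<close> by (intro inv[symmetric]) auto
    also have "a * (h / a ^ Suc m) = h / a ^ m"
      using a by simp
    finally show ?case using Suc.IH by simp
  qed simp
  have "(\<lambda>m. h * (1 / a) ^ m) \<longlonglongrightarrow> h * 0"
    using a by (intro tendsto_intros LIMSEQ_realpow_zero) auto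
  then have "filterlim (\<lambda>m. h / a ^ m) (at 0) sequentially"
    using a \<open>h \<noteq> 0\<close> by (auto simp: filterlim_at power_divide)
  with lim have "(\<lambda>m. G (h / a ^ m)) \<longlonglongrightarrow> L"
    by (rule filterlim_compose)
  then have "(\<lambda>m. G h) \<longlonglongrightarrow> L"
    by (simp add: step)
  then show ?thesis
    by (simp add: LIMSEQ_const_iff)
qed

lemma continuous_antiderivative:
  assumes "continuous_on UNIV (f :: real \<Rightarrow> real)"
  obtains \<Phi> where "\<And>x. (\<Phi> has_real_derivative f x) (at x)"
proof -
  have "\<exists>\<Phi>. \<forall>x. - \<infinity> < ereal x \<longrightarrow> ereal x < \<infinity> \<longrightarrow> (\<Phi> has_vector_derivative f x) (at x)"
    using assms by (intro einterval_antiderivative) (auto simp: continuous_on_eq_continuous_at)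
  then show ?thesis
    using that by (auto simp: has_real_derivative_iff_has_vector_derivative)
qed

text \<open>The scaling law makes the quotient equal to its limit \<open>L\<close> away from \<open>0\<close>. The quotient
  being a real number, this excludes \<open>L = \<plusminus>\<infinity>\<close> and identifies the constant \<open>c\<close> as the integral of
  \<open>f\<close> over \<open>[1, 2]\<close>.\<close>

lemma solution_forward_difference:
  assumes "a \<ge> 2" and cont: "continuous_on UNIV f" and E: "solves_E n a f"
    and lim: "((\<lambda>h. ereal (integral {h..h + 1} f / h ^ n)) \<longlongrightarrow> L) (at 0)"
  obtains c where "\<And>x. f (x + 1) - f x = c * (real n * x ^ (n - 1))"
proof -
  obtain \<Phi> where \<Phi>: "\<And>x. (\<Phi> has_real_derivative f x) (at x)"
    using continuous_antiderivative[OF cont] by blast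
  define F where "F h = \<Phi> (h + 1) - \<Phi> h" for h
  have int: "integral {h..h + 1} f = F h" for h
    unfolding F_def using \<Phi>
    by (intro integral_unique fundamental_theorem_of_calculus)
       (auto simp: has_real_derivative_iff_has_vector_derivative has_vector_derivative_at_within)
  have scaling: "F (real a * h) = real a ^ n * F h" for h
    unfolding F_def using assms(1) by (intro unit_integral_scaling[OF _ E \<Phi>]) auto
  have quot: "ereal (F h / h ^ n) = L" if "h \<noteq> 0" for h
  proof (rule scale_invariant_const[where a = "real a" and G = "\<lambda>h. ereal (F h / h ^ n)"])
    show "((\<lambda>h. ereal (F h / h ^ n)) \<longlongrightarrow> L) (at 0)"
      using lim by (simp add: int)
  qed (use assms(1) that scaling in \<open>auto simp: power_mult_distrib\<close>)
  define c where "c = F 1"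
  have F_off_0: "F h = c * h ^ n" if "h \<noteq> 0" for h
  proof -
    have "ereal (F h / h ^ n) = ereal (F 1 / 1 ^ n)"
      using quot[OF that] quot[of 1] by simp
    then show ?thesis
      using that by (simp add: c_def field_simps)
  qed
  have F': "(F has_real_derivative f (x + 1) - f x) (at x)" for x
    unfolding F_def by (auto intro!: derivative_eq_intros DERIV_chain2[OF \<Phi>] \<Phi>)
  \<comment> \<open>The quotient says nothing at \<open>h = 0\<close>; there the formula follows by continuity.\<close>
  have "F 0 = c * 0 ^ n"
  proof (rule LIM_unique)
    show "(F \<longlongrightarrow> F 0) (at 0)"
      using DERIV_isCont[OF F'] by (simp add: isCont_def)
    have "((\<lambda>h. c * h ^ n) \<longlongrightarrow> c * 0 ^ n) (at 0)"
      by (intro tendsto_intros)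
    then show "(F \<longlongrightarrow> c * 0 ^ n) (at 0)"
      by (rule Lim_transform_eventually) (auto simp: eventually_at_filter F_off_0)
  qed
  with F_off_0 have F: "F = (\<lambda>h. c * h ^ n)"
    by (metis (full_types))
  have "f (x + 1) - f x = c * (real n * x ^ (n - 1))" for x
  proof (rule DERIV_unique[OF F'])
    show "(F has_real_derivative c * (real n * x ^ (n - 1))) (at x)"
      unfolding F by (auto intro!: derivative_eq_intros)
  qed
  then show ?thesis using that by blast
qed

section \<open>Continuous solutions\<close>

theorem theorem3p6:
  fixes n a :: nat and f :: "real \<Rightarrow> real"
  assumes "a \<ge> 2"
    and "continuous_on UNIV f"
    and "\<exists>L::ereal. ((\<lambda>h. ereal (integral {h..h + 1} f / h ^ n)) \<longlongrightarrow> L) (at 0)"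
  shows "solves_E n a f \<longleftrightarrow>
    (\<exists>(c::real) (\<tau>::real \<Rightarrow> real).
       continuous_on UNIV \<tau> \<and> (\<forall>x. \<tau> (x + 1) = \<tau> x) \<and> solves_E n a \<tau> \<and>
       (\<forall>x. f x = c * bernpoly n x + \<tau> x))"
proof
  have B: "solves_E n a (bernpoly n)"
    using assms(1) by (intro solves_E_bernpoly) simp
  {
    assume E: "solves_E n a f"
    obtain L where "((\<lambda>h. ereal (integral {h..h + 1} f / h ^ n)) \<longlongrightarrow> L) (at 0)"
      using assms(3) by blast
    then obtain c where c: "\<And>x. f (x + 1) - f x = c * (real n * x ^ (n - 1))"
      using solution_forward_difference[OF assms(1,2) E] by blast
    define \<tau> where "\<tau> x = - c * bernpoly n x + f x" for x
    have "continuous_on UNIV \<tau>"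
      unfolding \<tau>_def by (intro continuous_intros continuous_on_bernpoly assms(2))
    moreover have "\<tau> (x + 1) = \<tau> x" for x
    proof -
      have "f (x + 1) - f x = c * (bernpoly n (x + 1) - bernpoly n x)"
        by (simp only: c bernpoly_forward_difference)
      then show ?thesis
        by (simp add: \<tau>_def algebra_simps)
    qed
    moreover have "solves_E n a \<tau>"
      unfolding \<tau>_def by (rule solves_E_add_scaled[OF B E])
    moreover have "f x = c * bernpoly n x + \<tau> x" for x
      by (simp add: \<tau>_def)
    ultimately show "\<exists>c \<tau>. continuous_on UNIV \<tau> \<and> (\<forall>x. \<tau> (x + 1) = \<tau> x) \<and> solves_E n a \<tau> \<and>
       (\<forall>x. f x = c * bernpoly n x + \<tau> x)"
      by blast
  next
    assume "\<exists>c \<tau>. continuous_on UNIV \<tau> \<and> (\<forall>x. \<tau> (x + 1) = \<tau> x) \<and> solves_E n a \<tau> \<and>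
       (\<forall>x. f x = c * bernpoly n x + \<tau> x)"
    then obtain c \<tau> where "solves_E n a \<tau>" "f = (\<lambda>x. c * bernpoly n x + \<tau> x)"
      by blast
    then show "solves_E n a f"
      using solves_E_add_scaled[OF B] by simp
  }
qed

end
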